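(* Let $0<p<1$, $q=1-p$, and let $(T_n)_{n\ge 0}$ be the random recursive tree process with uniform attachment insertion (probability $p$ at each step) and with deletion (probability $q$ at each step) governed by deletion matrices $\boldsymbol{Q}_{k+1,k}$, $k\ge 0$. Let $S_n$ be the stratum number of $T_n$. Let $n\ge 1$. Then, conditioned on stratum number, each tree is equiprobable at time $n$ (that is, $\mathbb{P}\{T_n=t\mid S_n=k\}=\frac{1}{k!}$ for every $0\le k\le n$ and every stratum $k$ tree $t$) if and only if $$\boldsymbol{1}_{1\times (k+1)!}\,\boldsymbol{Q}_{k+1,k}\;\propto\;\boldsymbol{1}_{1\times k!}\qquad (0\le k\le n-1),$$ where $\boldsymbol{1}_{1\times m}$ is the all-ones row vector of length $m$ and $\propto$ means "is a scalar multiple of". The latter condition is equivalent to requiring all column sums of $\boldsymbol{Q}_{k+1,k}$ to be identical (for each $0\le k\le n-1$).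
   Context: A recursive tree with $m$ nodes is a rooted tree with nodes labeled $1,\dots,m$, rooted at node $1$, whose labels increase along every path away from the root. The size of a tree is its number of nodes; its stratum number is its size minus one. Stratum $k$ is the set of all recursive trees with stratum number $k$; it contains $k!$ trees, listed in some fixed order. The process $(T_n)_{n\ge0}$ is a Markov chain on recursive trees. $T_0$ is the single-node tree. At each step, with probability $p$ a node is inserted: from a stratum $k$ tree, a new node labeled $k+2$ is attached as a child of one of the $k+1$ existing nodes chosen uniformly at random (uniform attachment). With probability $q=1-p$ a deletion takes place: a stratum $k+1$ tree is replaced by a stratum $k$ tree (a node is removed and the remaining nodes are reattached and relabeled to form a recursive tree); if the current tree is the single-node tree, it is left unchanged. A deletion rule is a specification, for each $k\ge 0$, of the $(k+1)!\times k!$ nonnegative matrix $\boldsymbol{Q}_{k+1,k}$, whose $(s,t)$ entry is the one-step probability of moving from the stratum $k+1$ tree $s$ to the stratum $k$ tree $t$ (each row of $\boldsymbol{Q}_{k+1,k}$ sums to $q$).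
   Formalization: As printed, "only if" fails for n≥3 (Q_{n,n-1} is not used by time n; at n=3 Q_{3,2} is arbitrary). Proved instead: equiprobable at both times n and n+1 iff the condition holds for 0≤k≤n-1; also equiprobable at all times ≥1 iff it holds for all k. *)

theory Defs
  imports "HOL-Probability.Probability" "Jordan_Normal_Form.Matrix"
begin

section \<open>Recursive trees\<close>

text \<open>Edges are directed away from the root, i.e. they are pairs (parent, child).\<close>

definition rooted_tree :: "'a set \<Rightarrow> 'a \<Rightarrow> ('a \<times> 'a) set \<Rightarrow> bool" where
  "rooted_tree V r E \<longleftrightarrow>
     r \<in> V \<and> E \<subseteq> V \<times> V \<and>
     (\<forall>u. (u, r) \<notin> E) \<and> (\<forall>v \<in> V - {r}. \<exists>!u. (u, v) \<in> E) \<and>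
     (\<forall>v \<in> V. (r, v) \<in> E\<^sup>*)"

datatype ltree = LTree (tree_size: nat) (edges: "(nat \<times> nat) set")

definition recursive_tree :: "ltree \<Rightarrow> bool" where
  "recursive_tree t \<longleftrightarrow>
     rooted_tree {1..tree_size t} 1 (edges t) \<and>
     (\<forall>u v. (u, v) \<in> (edges t)\<^sup>+ \<longrightarrow> u < v)"

definition stratum_number :: "ltree \<Rightarrow> nat" where
  "stratum_number t = tree_size t - 1"

definition stratum :: "nat \<Rightarrow> ltree set" where
  "stratum k = {t. recursive_tree t \<and> stratum_number t = k}"

definition single_node :: ltree where
  "single_node = LTree 1 {}"

definition attach :: "ltree \<Rightarrow> nat \<Rightarrow> ltree" where
  "attach t v = LTree (tree_size t + 1) (insert (v, tree_size t + 1) (edges t))"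


section \<open>Markov chains\<close>

text \<open>A process with state space \<open>A\<close>, initial state \<open>x0\<close> and one-step transition
  probabilities \<open>K\<close>; the Markov property is the elementary one for discrete chains.\<close>

definition markov_chain ::
  "'w measure \<Rightarrow> 's set \<Rightarrow> 's \<Rightarrow> ('s \<Rightarrow> 's \<Rightarrow> real) \<Rightarrow> (nat \<Rightarrow> 'w \<Rightarrow> 's) \<Rightarrow> bool" where
  "markov_chain M A x0 K X \<longleftrightarrow>
     prob_space M \<and> (\<forall>n. X n \<in> measurable M (count_space A)) \<and>
     (AE \<omega> in M. X 0 \<omega> = x0) \<and>
     (\<forall>n x. \<forall>y \<in> A.
        \<P>(\<omega> in M. \<forall>i\<le>n. X i \<omega> = x i) > 0 \<longrightarrow>
        \<P>(\<omega> in M. X (Suc n) \<omega> = y \<bar> \<forall>i\<le>n. X i \<omega> = x i) = K (x n) y)"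


section \<open>The tree process\<close>

text \<open>\<open>Q k s t\<close> is the entry of the deletion matrix from stratum \<open>k + 1\<close> to stratum \<open>k\<close> at
  row \<open>s\<close> and column \<open>t\<close>. Other arguments are irrelevant.\<close>

definition deletion_rule :: "real \<Rightarrow> (nat \<Rightarrow> ltree \<Rightarrow> ltree \<Rightarrow> real) \<Rightarrow> bool" where
  "deletion_rule q Q \<longleftrightarrow>
     (\<forall>k. \<forall>s \<in> stratum (k + 1).
        (\<forall>t \<in> stratum k. Q k s t \<ge> 0) \<and> (\<Sum>t \<in> stratum k. Q k s t) = q)"

text \<open>The factor \<open>q\<close> is already contained in the entries of \<open>Q\<close>, so it only appears explicitly
  for the single-node tree, which a deletion leaves unchanged.\<close>

definition step_prob ::
  "real \<Rightarrow> real \<Rightarrow> (nat \<Rightarrow> ltree \<Rightarrow> ltree \<Rightarrow> real) \<Rightarrow> ltree \<Rightarrow> ltree \<Rightarrow> real" where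
  "step_prob p q Q s t =
     p * pmf (map_pmf (attach s) (pmf_of_set {1..tree_size s})) t +
     (case stratum_number s of
        0 \<Rightarrow> if t = s then q else 0
      | Suc k \<Rightarrow> if t \<in> stratum k then Q k s t else 0)"

definition tree_process ::
  "real \<Rightarrow> real \<Rightarrow> (nat \<Rightarrow> ltree \<Rightarrow> ltree \<Rightarrow> real) \<Rightarrow> 'w measure \<Rightarrow> (nat \<Rightarrow> 'w \<Rightarrow> ltree) \<Rightarrow> bool"
  where
  "tree_process p q Q M T \<longleftrightarrow>
     markov_chain M {t. recursive_tree t} single_node (step_prob p q Q) T"

definition equiprobable_at :: "'w measure \<Rightarrow> (nat \<Rightarrow> 'w \<Rightarrow> ltree) \<Rightarrow> nat \<Rightarrow> bool" where
  "equiprobable_at M T n \<longleftrightarrow>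
     (\<forall>k\<le>n. \<forall>t \<in> stratum k.
        \<P>(\<omega> in M. T n \<omega> = t \<bar> stratum_number (T n \<omega>) = k) = 1 / fact k)"


section \<open>Deletion matrices\<close>

definition stratum_listing :: "(nat \<Rightarrow> ltree list) \<Rightarrow> bool" where
  "stratum_listing L \<longleftrightarrow> (\<forall>k. distinct (L k) \<and> set (L k) = stratum k)"

definition deletion_matrix ::
  "(nat \<Rightarrow> ltree list) \<Rightarrow> (nat \<Rightarrow> ltree \<Rightarrow> ltree \<Rightarrow> real) \<Rightarrow> nat \<Rightarrow> real mat" where
  "deletion_matrix L Q k =
     Matrix.mat (fact (k + 1)) (fact k) (\<lambda>(i, j). Q k (L (k + 1) ! i) (L k ! j))"

definition ones_row :: "nat \<Rightarrow> real mat" where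
  "ones_row m = Matrix.mat 1 m (\<lambda>_. 1)"

definition proportional :: "real mat \<Rightarrow> real mat \<Rightarrow> bool" where
  "proportional A B \<longleftrightarrow> (\<exists>c. A = c \<cdot>\<^sub>m B)"

definition column_sum :: "real mat \<Rightarrow> nat \<Rightarrow> real" where
  "column_sum A j = (\<Sum>i<dim_row A. A $$ (i, j))"

end

theory Submission
  imports Defs
begin

text \<open>
  A tree of positive stratum \<open>k\<close> arises by attachment from exactly one tree of stratum \<open>k - 1\<close>, so
  if the law at time \<open>n\<close> is constant on each stratum, then insertions contribute to the law at time
  \<open>n + 1\<close> a constant on each stratum. Deletions contribute at a stratum \<open>k\<close> tree \<open>t\<close> the column sum
  at \<open>t\<close> of the deletion matrix from stratum \<open>k + 1\<close>, scaled by the common probability of the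
  stratum \<open>k + 1\<close> trees, which is positive exactly when \<open>k + 1 \<le> n\<close>. Hence equiprobability
  persists from \<open>n\<close> to \<open>n + 1\<close> iff the column sums are constant for all \<open>k < n\<close>.
\<close>

section \<open>Recursive trees, strata and attachment\<close>

text \<open>Reachability from the root follows from the conditions on single edges: passing to the
  parent strictly lowers the label, so the walk ends at 1, the only node without a parent. The
  edgewise form is easy to check under adding or removing one edge.\<close>

lemma recursive_tree_iff:
  "recursive_tree t \<longleftrightarrow>
     1 \<le> tree_size t \<and> edges t \<subseteq> {1..tree_size t} \<times> {1..tree_size t} \<and>
     (\<forall>(u, v) \<in> edges t. u < v) \<and> (\<forall>v \<in> {2..tree_size t}. \<exists>!u. (u, v) \<in> edges t)"
  (is "_ \<longleftrightarrow> ?R")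
proof
  assume t: "recursive_tree t"
  then have "u < v" if "(u, v) \<in> edges t" for u v
    using that unfolding recursive_tree_def by blast
  moreover have "{2..tree_size t} = {1..tree_size t} - {1}"
    by auto
  ultimately show ?R
    using t unfolding recursive_tree_def rooted_tree_def by auto
next
  assume R: ?R
  have less: "u < v" if "(u, v) \<in> (edges t)\<^sup>+" for u v
    using that R by (induction rule: trancl_induct) fastforce+
  have reach: "(1, v) \<in> (edges t)\<^sup>*" if "v \<in> {1..tree_size t}" for v
    using that
  proof (induction v rule: less_induct)
    case (less v)
    show ?case
    proof (cases "v = 1")
      case False
      with less.prems have "v \<in> {2..tree_size t}"
        by auto
      with R obtain u where "(u, v) \<in> edges t"
        by blast
      moreover from this R have "u < v" "u \<in> {1..tree_size t}"
        by auto
      ultimately show ?thesis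
        using less.IH by (meson rtrancl.rtrancl_into_rtrancl)
    qed simp
  qed
  have "(u, 1) \<notin> edges t" for u
    using R by fastforce
  moreover have "\<exists>!u. (u, v) \<in> edges t" if "v \<in> {1..tree_size t} - {1}" for v
  proof -
    from that have "v \<in> {2..tree_size t}"
      by auto
    with R show ?thesis
      by blast
  qed
  ultimately show "recursive_tree t"
    using R less reach unfolding recursive_tree_def rooted_tree_def by simp
qed

text \<open>The condition \<open>1 \<le> tree_size t\<close> excludes size 0, whose truncated
  stratum number would also be 0.\<close>

lemma stratum_iff:
  "t \<in> stratum k \<longleftrightarrow>
     tree_size t = Suc k \<and> edges t \<subseteq> {1..Suc k} \<times> {1..Suc k} \<and>
     (\<forall>(u, v) \<in> edges t. u < v) \<and> (\<forall>v \<in> {2..Suc k}. \<exists>!u. (u, v) \<in> edges t)"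
  unfolding stratum_def stratum_number_def recursive_tree_iff
  by (cases "tree_size t = Suc k") auto

lemma tree_size_stratum: "t \<in> stratum k \<Longrightarrow> tree_size t = Suc k"
  by (simp add: stratum_iff)

lemma stratum_number_stratum: "t \<in> stratum k \<Longrightarrow> stratum_number t = k"
  by (simp add: stratum_def)

lemma recursive_tree_if_stratum: "t \<in> stratum k \<Longrightarrow> recursive_tree t"
  by (simp add: stratum_def)

lemma recursive_tree_stratum: "recursive_tree s \<Longrightarrow> s \<in> stratum (stratum_number s)"
  by (simp add: stratum_def)

lemma stratum_disjoint: "s \<in> stratum j \<Longrightarrow> s \<in> stratum k \<longleftrightarrow> j = k"
  by (auto simp: stratum_def)

lemma stratum_0: "stratum 0 = {single_node}"
proof -
  have "t = single_node" if "t \<in> stratum 0" for t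
    using that by (cases t) (fastforce simp: stratum_iff single_node_def)
  moreover have "single_node \<in> stratum 0"
    by (simp add: stratum_iff single_node_def)
  ultimately show ?thesis
    by blast
qed

lemma attach_in_stratum:
  assumes s: "s \<in> stratum k" and v: "v \<in> {1..Suc k}"
  shows "attach s v \<in> stratum (Suc k)"
proof -
  have size: "tree_size s = Suc k" and sub: "edges s \<subseteq> {1..Suc k} \<times> {1..Suc k}"
    and less: "\<forall>(u, v) \<in> edges s. u < v"
    and par: "\<forall>v \<in> {2..Suc k}. \<exists>!u. (u, v) \<in> edges s"
    using s by (simp_all add: stratum_iff)
  have "tree_size (attach s v) = Suc (Suc k)"
    by (simp add: attach_def size)
  moreover have "edges (attach s v) \<subseteq> {1..Suc (Suc k)} \<times> {1..Suc (Suc k)}"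
    using sub v by (auto simp: attach_def size)
  moreover have "\<forall>(u, w) \<in> edges (attach s v). u < w"
    using less v by (auto simp: attach_def size)
  moreover have "\<exists>!u. (u, w) \<in> edges (attach s v)" if w: "w \<in> {2..Suc (Suc k)}" for w
  proof (cases "w = Suc (Suc k)")
    case True
    then show ?thesis
      using sub by (auto simp: attach_def size)
  next
    case False
    with w have "w \<in> {2..Suc k}"
      by auto
    then show ?thesis
      using par False by (auto simp: attach_def size)
  qed
  ultimately show ?thesis
    unfolding stratum_iff by blast
qed

lemma attach_image_subset: "s \<in> stratum k \<Longrightarrow> attach s ` {1..Suc k} \<subseteq> stratum (Suc k)"
  using attach_in_stratum by blast

text \<open>The new label \<open>k + 2\<close> occurs in no edge of the old trees, so the unique
  edge into it reveals the chosen parent, and removing that edge recovers the old tree.\<close>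

lemma attach_inj:
  assumes "s \<in> stratum k" "s' \<in> stratum k" "attach s v = attach s' v'"
  shows "s = s'" "v = v'"
proof -
  let ?m = "Suc (Suc k)"
  have size: "tree_size s = Suc k" "tree_size s' = Suc k"
    using assms by (simp_all add: stratum_iff)
  have new: "(u, ?m) \<notin> edges s" "(u, ?m) \<notin> edges s'" for u
    using assms by (auto simp: stratum_iff)
  have eq: "insert (v, ?m) (edges s) = insert (v', ?m) (edges s')"
    using assms(3) by (simp add: attach_def size)
  show "v = v'"
    using eq new by blast
  with eq new have "edges s = edges s'"
    by (metis insert_ident)
  with size show "s = s'"
    by (simp add: ltree.expand)
qed

text \<open>The node with the largest label is a leaf, since edges increase; cutting it off together
  with its parent edge leaves a recursive tree.\<close>

lemma stratum_Suc_cases: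
  assumes t: "t \<in> stratum (Suc k)"
  obtains s v where "s \<in> stratum k" "v \<in> {1..Suc k}" "t = attach s v"
proof -
  let ?m = "Suc (Suc k)"
  have size: "tree_size t = ?m" and sub: "edges t \<subseteq> {1..?m} \<times> {1..?m}"
    and less: "\<And>u v. (u, v) \<in> edges t \<Longrightarrow> u < v"
    and par: "\<And>v. v \<in> {2..?m} \<Longrightarrow> \<exists>!u. (u, v) \<in> edges t"
    using t by (auto simp: stratum_iff)
  from par[of ?m] obtain u where u: "(u, ?m) \<in> edges t" and
    uniq: "\<And>w. (w, ?m) \<in> edges t \<Longrightarrow> w = u"
    by auto
  define s where "s = LTree (Suc k) (edges t - {(u, ?m)})"
  \<comment> \<open>Only the edge from \<open>u\<close> enters the largest label, so the remaining
    edges have heads at most \<open>Suc k\<close>, and \<open>a < b\<close> bounds their tails as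
    well.\<close>
  have "(a, b) \<in> {1..Suc k} \<times> {1..Suc k}" if ab: "(a, b) \<in> edges t - {(u, ?m)}" for a b
  proof -
    have "b \<noteq> ?m"
      using ab uniq by auto
    moreover have "a < b" "1 \<le> a" "b \<le> ?m"
      using ab less sub by auto
    ultimately show ?thesis
      by auto
  qed
  then have "edges t - {(u, ?m)} \<subseteq> {1..Suc k} \<times> {1..Suc k}"
    by (rule subrelI)
  moreover have "\<forall>(a, b) \<in> edges t - {(u, ?m)}. a < b"
    using less by auto
  moreover have "\<exists>!w. (w, v) \<in> edges t - {(u, ?m)}" if "v \<in> {2..Suc k}" for v
  proof -
    from that have "v \<in> {2..?m}" "v \<noteq> ?m"
      by auto
    then show ?thesis
      using par[of v] by simp
  qed
  ultimately have "s \<in> stratum k"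
    unfolding stratum_iff s_def ltree.sel by blast
  moreover have "u \<in> {1..Suc k}"
    using less[OF u] u sub by auto
  moreover have "t = attach s u"
    using u size by (cases t) (auto simp: attach_def s_def)
  ultimately show thesis
    by (rule that)
qed

text \<open>This carries the count: stratum \<open>k + 1\<close> has \<open>k + 1\<close> times as
  many trees as stratum \<open>k\<close>, whence finiteness and the cardinality
  \<open>fact k\<close>.\<close>

lemma bij_betw_attach:
  "bij_betw (\<lambda>(s, v). attach s v) (stratum k \<times> {1..Suc k}) (stratum (Suc k))"
  unfolding bij_betw_def
proof
  show "inj_on (\<lambda>(s, v). attach s v) (stratum k \<times> {1..Suc k})"
    using attach_inj by (auto simp: inj_on_def)
  show "(\<lambda>(s, v). attach s v) ` (stratum k \<times> {1..Suc k}) = stratum (Suc k)"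
    using attach_in_stratum by (auto elim!: stratum_Suc_cases simp del: atLeastAtMost_iff)
qed

lemma finite_stratum: "finite (stratum k)"
proof (induction k)
  case (Suc k)
  then show ?case
    using bij_betw_finite[OF bij_betw_attach[of k]] by simp
qed (simp add: stratum_0)

lemma card_stratum: "card (stratum k) = fact k"
proof (induction k)
  case (Suc k)
  then show ?case
    using bij_betw_same_card[OF bij_betw_attach[of k]] by (simp add: card_cartesian_product algebra_simps)
qed (simp add: stratum_0)

lemma recursive_trees_eq_Union_stratum: "{t. recursive_tree t} = (\<Union>k. stratum k)"
  by (auto simp: stratum_def)

lemma countable_recursive_trees: "countable {t. recursive_tree t}"
  unfolding recursive_trees_eq_Union_stratum
  by (rule countable_UN) (simp_all add: countable_finite finite_stratum)

section \<open>One-step transition probabilities\<close>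

text \<open>Different parents give different trees, so the uniform law on the nodes is pushed
  forward to the uniform law on the attached trees.\<close>

lemma pmf_attach:
  assumes s: "s \<in> stratum j"
  shows "pmf (map_pmf (attach s) (pmf_of_set {1..tree_size s})) t =
           (if t \<in> attach s ` {1..Suc j} then 1 / real (Suc j) else 0)"
proof -
  have "inj_on (attach s) {1..Suc j}"
    using attach_inj[OF s s] by (auto simp: inj_on_def)
  then show ?thesis
    using s by (subst map_pmf_of_set_inj) (auto simp: tree_size_stratum card_image)
qed

lemma step_prob_up:
  assumes s: "s \<in> stratum k" and s': "s' \<in> stratum k" and v: "v \<in> {1..Suc k}"
  shows "step_prob p q Q s (attach s' v) = (if s = s' then p / real (Suc k) else 0)"
proof -
  have "attach s' v \<in> attach s ` {1..Suc k} \<longleftrightarrow> s = s'"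
    using v by (auto dest: attach_inj(1)[OF s' s] simp del: atLeastAtMost_iff)
  \<comment> \<open>The first fact removes the deletion term for \<open>k = 0\<close>, the second
    for \<open>k = Suc i\<close>, where \<open>k - 1\<close> is \<open>i\<close>.\<close>
  moreover have "attach s' v \<noteq> s" "attach s' v \<notin> stratum (k - 1)"
    using attach_in_stratum[OF s' v] s by (auto simp: stratum_def)
  ultimately show ?thesis
    unfolding step_prob_def pmf_attach[OF s] by (auto simp: stratum_number_stratum[OF s] split: nat.split)
qed

lemma step_prob_down:
  assumes s: "s \<in> stratum (Suc k)" and t: "t \<in> stratum k"
  shows "step_prob p q Q s t = Q k s t"
proof -
  have "t \<notin> attach s ` {1..Suc (Suc k)}"
    using attach_image_subset[OF s] stratum_disjoint[OF t, of "Suc (Suc k)"] by auto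
  then show ?thesis
    unfolding step_prob_def pmf_attach[OF s] using t by (simp add: stratum_number_stratum[OF s])
qed

lemma step_prob_single_node: "step_prob p q Q single_node single_node = q"
proof -
  have s: "single_node \<in> stratum 0"
    by (simp add: stratum_0)
  have "single_node \<notin> attach single_node ` {1..Suc 0}"
    using attach_image_subset[OF s] stratum_disjoint[OF s, of "Suc 0"] by auto
  then show ?thesis
    unfolding step_prob_def pmf_attach[OF s] by (simp add: stratum_number_stratum[OF s])
qed

text \<open>Insertion raises the stratum by one and deletion lowers it by one; the only other move
  is the deletion that fixes the single node, which is the last case excluded.\<close>

lemma step_prob_eq_0:
  assumes s: "s \<in> stratum j" and t: "t \<in> stratum k"
    and "k \<noteq> Suc j" "j \<noteq> Suc k" "\<not> (j = 0 \<and> k = 0)"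
  shows "step_prob p q Q s t = 0"
proof -
  have "t \<notin> attach s ` {1..Suc j}"
    using attach_image_subset[OF s] stratum_disjoint[OF t, of "Suc j"] assms(3) by blast
  moreover have "t \<noteq> s" if "j = 0"
    using that assms by (auto simp: stratum_disjoint)
  moreover have "t \<notin> stratum i" if "j = Suc i" for i
    using that assms by (auto simp: stratum_disjoint)
  ultimately show ?thesis
    unfolding step_prob_def pmf_attach[OF s]
    by (auto simp: stratum_number_stratum[OF s] split: nat.split)
qed

lemma step_prob_nonneg:
  assumes "0 \<le> p" "0 \<le> q" "deletion_rule q Q" "recursive_tree s"
  shows "0 \<le> step_prob p q Q s t"
  using assms unfolding step_prob_def deletion_rule_def
  by (auto simp: stratum_def split: nat.split)


section \<open>Markov chains on a countable state space\<close>

lemma sets_eq_count_space: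
  assumes "X \<in> measurable M (count_space A)"
  shows "{\<omega> \<in> space M. X \<omega> = z} \<in> sets M"
proof -
  \<comment> \<open>The value \<open>z\<close> may lie outside \<open>A\<close>, where the preimage
    is empty.\<close>
  have "X -` ({z} \<inter> A) \<inter> space M \<in> sets M"
    by (rule measurable_sets[OF assms]) simp
  moreover have "X -` ({z} \<inter> A) \<inter> space M = {\<omega> \<in> space M. X \<omega> = z}"
    using measurable_space[OF assms] by auto
  ultimately show ?thesis
    by simp
qed

lemma emeasure_partition_count_space:
  assumes X: "X \<in> measurable M (count_space A)" and A: "countable A" and E: "E \<in> sets M"
  shows "emeasure M E = (\<integral>\<^sup>+x. emeasure M (E \<inter> {\<omega> \<in> space M. X \<omega> = x}) \<partial>count_space A)"
proof -
  have "E = (\<Union>x\<in>A. E \<inter> {\<omega> \<in> space M. X \<omega> = x})"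
    using measurable_space[OF X] sets.sets_into_space[OF E] by auto
  moreover have "emeasure M (\<Union>x\<in>A. E \<inter> {\<omega> \<in> space M. X \<omega> = x}) =
      (\<integral>\<^sup>+x. emeasure M (E \<inter> {\<omega> \<in> space M. X \<omega> = x}) \<partial>count_space A)"
    using A E sets_eq_count_space[OF X]
    by (intro emeasure_UN_countable) (auto simp: disjoint_family_on_def)
  ultimately show ?thesis
    by simp
qed

text \<open>The defining property of a Markov chain conditions on the whole history (\<open>m = 0\<close>); summing over
  the state at time \<open>m\<close> forgets one more coordinate at a time.\<close>
lemma markov_chain_history_Suc:
  assumes M: "markov_chain M A x0 K X" and A: "countable A"
    and K: "\<And>x y. x \<in> A \<Longrightarrow> y \<in> A \<Longrightarrow> 0 \<le> K x y"
    and "m \<le> n" and "x n \<in> A" and y: "y \<in> A"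
  shows "emeasure M {\<omega> \<in> space M. X (Suc n) \<omega> = y \<and> (\<forall>i\<in>{m..n}. X i \<omega> = x i)} =
         ennreal (K (x n) y) * emeasure M {\<omega> \<in> space M. \<forall>i\<in>{m..n}. X i \<omega> = x i}"
proof -
  interpret prob_space M
    using M by (simp add: markov_chain_def)
  have X: "X i \<in> measurable M (count_space A)" for i
    using M by (simp add: markov_chain_def)
  note eq = sets_eq_count_space[OF X]
  have H: "{\<omega> \<in> space M. \<forall>i\<in>{m..n}. X i \<omega> = x i} \<in> sets M" for m x
    by (intro sets.sets_Collect_finite_All eq) auto
  have J: "{\<omega> \<in> space M. X (Suc n) \<omega> = y \<and> (\<forall>i\<in>{m..n}. X i \<omega> = x i)} \<in> sets M" for m x
    by (intro sets.sets_Collect_conj eq H)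
  show ?thesis
    using \<open>m \<le> n\<close> \<open>x n \<in> A\<close>
  proof (induction m arbitrary: x)
    case 0
    let ?H = "{\<omega> \<in> space M. \<forall>i\<le>n. X i \<omega> = x i}"
    let ?J = "{\<omega> \<in> space M. X (Suc n) \<omega> = y \<and> (\<forall>i\<le>n. X i \<omega> = x i)}"
    have "?H \<in> sets M"
      using H[of 0 x] unfolding atLeast0AtMost Ball_def atMost_iff .
    have "measure M ?J = K (x n) y * measure M ?H"
    \<comment> \<open>The Markov property speaks only of histories of positive probability; for a
      null history both sides vanish.\<close>
    proof (cases "measure M ?H = 0")
      case True
      have "measure M ?J \<le> measure M ?H"
        by (rule finite_measure_mono[OF _ \<open>?H \<in> sets M\<close>]) auto
      with True show ?thesis
        by (simp add: measure_le_0_iff)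
    next
      case False
      then have "measure M ?H > 0"
        by (simp add: zero_less_measure_iff)
      with M y have "cond_prob M (\<lambda>\<omega>. X (Suc n) \<omega> = y) (\<lambda>\<omega>. \<forall>i\<le>n. X i \<omega> = x i) = K (x n) y"
        unfolding markov_chain_def by blast
      with False show ?thesis
        by (simp add: cond_prob_def field_simps)
    qed
    with K[OF 0(2) y] show ?case
      by (simp add: emeasure_eq_measure ennreal_mult Ball_def)
  next
    case (Suc m)
    \<comment> \<open>Fixing the state at time \<open>m\<close> to be \<open>z\<close> turns a
      history from \<open>m + 1\<close> into a history from \<open>m\<close> along the updated path,
      hence the induction over arbitrary \<open>x\<close>.\<close>
    have *: "(\<forall>i\<in>{Suc m..n}. X i \<omega> = x i) \<and> X m \<omega> = z \<longleftrightarrow>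
             (\<forall>i\<in>{m..n}. X i \<omega> = (x(m := z)) i)" for z \<omega>
    proof -
      have "{m..n} = insert m {Suc m..n}"
        using Suc.prems(1) by auto
      then show ?thesis
        by auto
    qed
    let ?H = "\<lambda>z. {\<omega> \<in> space M. \<forall>i\<in>{m..n}. X i \<omega> = (x(m := z)) i}"
    let ?J = "\<lambda>z. {\<omega> \<in> space M. X (Suc n) \<omega> = y \<and> (\<forall>i\<in>{m..n}. X i \<omega> = (x(m := z)) i)}"
    \<comment> \<open>Since \<open>m < n\<close>, the update leaves \<open>x n\<close> unchanged, so
      the factor \<open>K (x n) y\<close> does not depend on \<open>z\<close> and can be taken out
      of the integral.\<close>
    have IH: "emeasure M (?J z) = ennreal (K (x n) y) * emeasure M (?H z)" for z
      using Suc.IH[of "x(m := z)"] Suc.prems by simp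
    have split: "{\<omega> \<in> space M. \<forall>i\<in>{Suc m..n}. X i \<omega> = x i} \<inter> {\<omega> \<in> space M. X m \<omega> = z} = ?H z"
      "{\<omega> \<in> space M. X (Suc n) \<omega> = y \<and> (\<forall>i\<in>{Suc m..n}. X i \<omega> = x i)} \<inter>
         {\<omega> \<in> space M. X m \<omega> = z} = ?J z" for z
      unfolding *[symmetric] by auto
    show ?case
      unfolding emeasure_partition_count_space[OF X[of m] A H[of "Suc m" x]]
        emeasure_partition_count_space[OF X[of m] A J[of "Suc m" x]] split IH
      by (rule nn_integral_cmult) simp
  qed
qed

text \<open>The one-step forward equation: partition by the state at time \<open>n\<close>, and let
  the countable sum collapse to a finite set \<open>F\<close> containing every possible predecessor
  of \<open>y\<close>.\<close>

lemma markov_chain_forward: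
  assumes M: "markov_chain M A x0 K X" and A: "countable A"
    and K: "\<And>x y. x \<in> A \<Longrightarrow> y \<in> A \<Longrightarrow> 0 \<le> K x y" and y: "y \<in> A"
    and F: "finite F" "F \<subseteq> A" "\<And>x. x \<in> A - F \<Longrightarrow> K x y = 0"
  shows "\<P>(\<omega> in M. X (Suc n) \<omega> = y) = (\<Sum>x\<in>F. K x y * \<P>(\<omega> in M. X n \<omega> = x))"
proof -
  interpret prob_space M
    using M by (simp add: markov_chain_def)
  have X: "X i \<in> measurable M (count_space A)" for i
    using M by (simp add: markov_chain_def)
  have joint: "emeasure M ({\<omega> \<in> space M. X (Suc n) \<omega> = y} \<inter> {\<omega> \<in> space M. X n \<omega> = x}) =
      ennreal (K x y * \<P>(\<omega> in M. X n \<omega> = x))" if "x \<in> A" for x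
  proof -
    have "{\<omega> \<in> space M. X (Suc n) \<omega> = y} \<inter> {\<omega> \<in> space M. X n \<omega> = x} =
        {\<omega> \<in> space M. X (Suc n) \<omega> = y \<and> X n \<omega> = x}"
      by auto
    \<comment> \<open>With \<open>m = n\<close> the history \<open>{m..n}\<close> shrinks to the
      present state alone.\<close>
    with markov_chain_history_Suc[where x = "\<lambda>_. x" and n = n and m = n, OF M A K order_refl _ y]
    show ?thesis
      using that K[OF that y] by (simp add: emeasure_eq_measure ennreal_mult)
  qed
  have "ennreal (\<P>(\<omega> in M. X (Suc n) \<omega> = y)) =
      (\<integral>\<^sup>+x. ennreal (K x y * \<P>(\<omega> in M. X n \<omega> = x)) \<partial>count_space A)"
    unfolding emeasure_eq_measure[symmetric]
      emeasure_partition_count_space[OF X[of n] A sets_eq_count_space[OF X]]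
    by (rule nn_integral_cong) (simp add: joint)
  also have "\<dots> = (\<Sum>x\<in>F. ennreal (K x y * \<P>(\<omega> in M. X n \<omega> = x)))"
    using F by (intro nn_integral_count_space') auto
  also have "\<dots> = ennreal (\<Sum>x\<in>F. K x y * \<P>(\<omega> in M. X n \<omega> = x))"
    using F K y by (intro sum_ennreal) (auto intro!: mult_nonneg_nonneg)
  finally show ?thesis
    using F K y by (subst (asm) ennreal_inj) (auto intro!: sum_nonneg mult_nonneg_nonneg)
qed

lemma constant_on_iff_pairwise: "f constant_on A \<longleftrightarrow> (\<forall>x\<in>A. \<forall>y\<in>A. f x = f y)"
  unfolding constant_on_def by metis

section \<open>The law of the tree process at a fixed time\<close>

locale tree_process_context =
  fixes p q :: real and Q :: "nat \<Rightarrow> ltree \<Rightarrow> ltree \<Rightarrow> real"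
    and M :: "'w measure" and T :: "nat \<Rightarrow> 'w \<Rightarrow> ltree"
  assumes p_pos: "0 < p" and q_pos: "0 < q"
    and deletion: "deletion_rule q Q"
    and process: "tree_process p q Q M T"
begin

sublocale prob_space M
  using process by (simp add: tree_process_def markov_chain_def)

lemma T_measurable: "T n \<in> measurable M (count_space {t. recursive_tree t})"
  using process by (simp add: tree_process_def markov_chain_def)

definition tree_prob :: "nat \<Rightarrow> ltree \<Rightarrow> real" where
  "tree_prob n t = \<P>(\<omega> in M. T n \<omega> = t)"

lemma tree_prob_nonneg: "0 \<le> tree_prob n t"
  by (simp add: tree_prob_def)

lemma tree_prob_forward:
  assumes "t \<in> stratum k" and "finite F" "F \<subseteq> {s. recursive_tree s}"
    and "\<And>s. recursive_tree s \<Longrightarrow> s \<notin> F \<Longrightarrow> step_prob p q Q s t = 0"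
  shows "tree_prob (Suc n) t = (\<Sum>s\<in>F. step_prob p q Q s t * tree_prob n s)"
  unfolding tree_prob_def
  using p_pos q_pos deletion assms
  by (intro markov_chain_forward[OF process[unfolded tree_process_def] countable_recursive_trees])
    (auto intro: step_prob_nonneg simp: stratum_def)

text \<open>Only strata \<open>k\<close> and \<open>k + 2\<close> lead here, and within stratum
  \<open>k\<close> only \<open>s\<close> itself does, because attachment is injective. This gives
  the finite set of predecessors.\<close>

lemma tree_prob_Suc_attach:
  assumes s: "s \<in> stratum k" and v: "v \<in> {1..Suc k}"
  shows "tree_prob (Suc n) (attach s v) =
           p / real (Suc k) * tree_prob n s +
           (\<Sum>r\<in>stratum (Suc (Suc k)). Q (Suc k) r (attach s v) * tree_prob n r)"
proof -
  let ?F = "insert s (stratum (Suc (Suc k)))"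
  have t: "attach s v \<in> stratum (Suc k)"
    by (rule attach_in_stratum[OF s v])
  have s_notin: "s \<notin> stratum (Suc (Suc k))"
    using s by (simp add: stratum_disjoint)
  have zero: "step_prob p q Q r (attach s v) = 0" if r: "recursive_tree r" "r \<notin> ?F" for r
  proof (cases "stratum_number r = k")
    case True
    with r have "r \<in> stratum k"
      by (simp add: stratum_def)
    with r show ?thesis
      by (subst step_prob_up[OF _ s v]) auto
  next
    case False
    moreover have "stratum_number r \<noteq> Suc (Suc k)"
      using r by (auto simp: stratum_def)
    ultimately show ?thesis
      using step_prob_eq_0[OF recursive_tree_stratum[OF r(1)] t] by simp
  qed
  have "tree_prob (Suc n) (attach s v) = (\<Sum>r\<in>?F. step_prob p q Q r (attach s v) * tree_prob n r)"
    by (intro tree_prob_forward[OF t] zero)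
      (use s in \<open>auto simp: finite_stratum recursive_tree_if_stratum\<close>)
  also have "\<dots> = p / real (Suc k) * tree_prob n s +
      (\<Sum>r\<in>stratum (Suc (Suc k)). step_prob p q Q r (attach s v) * tree_prob n r)"
    using s_notin by (simp add: finite_stratum step_prob_up[OF s s v])
  finally show ?thesis
    by (simp add: step_prob_down[OF _ t])
qed

text \<open>No insertion produces the single node; the insertion term is replaced by the deletion
  that leaves it unchanged.\<close>

lemma tree_prob_Suc_single_node:
  "tree_prob (Suc n) single_node =
     q * tree_prob n single_node + (\<Sum>r\<in>stratum 1. Q 0 r single_node * tree_prob n r)"
proof -
  let ?F = "insert single_node (stratum 1)"
  have t: "single_node \<in> stratum 0"
    by (simp add: stratum_0)
  have notin: "single_node \<notin> stratum 1"
    using t by (simp add: stratum_disjoint)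
  have zero: "step_prob p q Q r single_node = 0" if r: "recursive_tree r" "r \<notin> ?F" for r
  proof -
    have "stratum_number r \<noteq> 0" "stratum_number r \<noteq> Suc 0"
      using recursive_tree_stratum[OF r(1)] r(2) stratum_0 by (metis One_nat_def insertCI singletonD)+
    then show ?thesis
      using step_prob_eq_0[OF recursive_tree_stratum[OF r(1)] t] by simp
  qed
  have "tree_prob (Suc n) single_node = (\<Sum>r\<in>?F. step_prob p q Q r single_node * tree_prob n r)"
    by (intro tree_prob_forward[OF t] zero)
      (use t in \<open>auto simp: finite_stratum recursive_tree_if_stratum\<close>)
  also have "\<dots> = q * tree_prob n single_node +
      (\<Sum>r\<in>stratum 1. step_prob p q Q r single_node * tree_prob n r)"
    using notin by (simp add: finite_stratum step_prob_single_node)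
  finally show ?thesis
    using step_prob_down[OF _ t] by simp
qed

lemma Q_nonneg: "s \<in> stratum (Suc k) \<Longrightarrow> t \<in> stratum k \<Longrightarrow> 0 \<le> Q k s t"
  using deletion by (simp add: deletion_rule_def)

lemma tree_prob_0: "tree_prob 0 t = (if t = single_node then 1 else 0)"
proof -
  have AE: "AE \<omega> in M. T 0 \<omega> = single_node"
    using process by (simp add: tree_process_def markov_chain_def)
  show ?thesis
  proof (cases "t = single_node")
    case True
    with AE show ?thesis
      using sets_eq_count_space[OF T_measurable]
      by (simp add: tree_prob_def prob_Collect_eq_1)
  next
    case False
    from AE have "AE \<omega> in M. T 0 \<omega> \<noteq> t"
      by eventually_elim (use False in auto)
    with False show ?thesis
      using sets_eq_count_space[OF T_measurable]
      by (simp add: tree_prob_def prob_Collect_eq_0)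
  qed
qed

text \<open>One path suffices: stay at the single node for \<open>n - k\<close> steps, then insert
  the nodes of \<open>t\<close> in order. The induction follows this path, and the other terms of
  the forward equation are nonnegative.\<close>

lemma tree_prob_pos: "t \<in> stratum k \<Longrightarrow> k \<le> n \<Longrightarrow> 0 < tree_prob n t"
proof (induction n arbitrary: t k)
  case 0
  then show ?case
    by (simp add: stratum_0 tree_prob_0)
next
  case (Suc n)
  show ?case
  proof (cases k)
    case 0
    with Suc.prems have "t = single_node"
      by (simp add: stratum_0)
    moreover have "0 < q * tree_prob n single_node"
      using Suc.IH[of single_node 0] q_pos by (simp add: stratum_0)
    moreover have "0 \<le> (\<Sum>r\<in>stratum 1. Q 0 r single_node * tree_prob n r)"
      using Q_nonneg[of _ 0 single_node]
      by (intro sum_nonneg mult_nonneg_nonneg) (auto simp: stratum_0 tree_prob_nonneg)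
    ultimately show ?thesis
      by (simp add: tree_prob_Suc_single_node)
  next
    case (Suc j)
    with Suc.prems obtain s v where s: "s \<in> stratum j" and v: "v \<in> {1..Suc j}"
      and t: "t = attach s v"
      by (auto elim: stratum_Suc_cases)
    have "0 < p / real (Suc j) * tree_prob n s"
      using Suc.IH[OF s] Suc.prems Suc p_pos by simp
    moreover have "0 \<le> (\<Sum>r\<in>stratum (Suc (Suc j)). Q (Suc j) r (attach s v) * tree_prob n r)"
      using attach_in_stratum[OF s v]
      by (intro sum_nonneg mult_nonneg_nonneg Q_nonneg) (auto simp: tree_prob_nonneg)
    ultimately show ?thesis
      unfolding t tree_prob_Suc_attach[OF s v] by simp
  qed
qed

text \<open>The stratum number starts at 0 and grows by at most one per step.\<close>

lemma tree_prob_eq_0: "t \<in> stratum k \<Longrightarrow> n < k \<Longrightarrow> tree_prob n t = 0"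
proof (induction n arbitrary: t k)
  case 0
  then show ?case
    using stratum_0 stratum_disjoint[of single_node 0 k] by (auto simp: tree_prob_0)
next
  case (Suc n)
  then obtain j where j: "k = Suc j"
    by (cases k) auto
  with Suc.prems obtain s v where s: "s \<in> stratum j" and v: "v \<in> {1..Suc j}"
    and t: "t = attach s v"
    by (auto elim: stratum_Suc_cases)
  have "tree_prob n s = 0"
    using Suc.IH[OF s] Suc.prems j by simp
  moreover have "tree_prob n r = 0" if "r \<in> stratum (Suc (Suc j))" for r
    using Suc.IH[OF that] Suc.prems j by simp
  ultimately show ?case
    unfolding t tree_prob_Suc_attach[OF s v] by simp
qed

section \<open>Conditioning on the stratum number and equiprobability\<close>

lemma prob_stratum_number:
  "\<P>(\<omega> in M. stratum_number (T n \<omega>) = k) = (\<Sum>t\<in>stratum k. tree_prob n t)"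
proof -
  have "{\<omega> \<in> space M. stratum_number (T n \<omega>) = k} = (\<Union>t\<in>stratum k. {\<omega> \<in> space M. T n \<omega> = t})"
    using measurable_space[OF T_measurable] by (auto simp: stratum_def)
  moreover have "prob (\<Union>t\<in>stratum k. {\<omega> \<in> space M. T n \<omega> = t}) =
      (\<Sum>t\<in>stratum k. prob {\<omega> \<in> space M. T n \<omega> = t})"
    using sets_eq_count_space[OF T_measurable]
    by (intro finite_measure_finite_Union) (auto simp: finite_stratum disjoint_family_on_def)
  ultimately show ?thesis
    by (simp add: tree_prob_def)
qed

lemma cond_prob_tree:
  assumes "t \<in> stratum k"
  shows "\<P>(\<omega> in M. T n \<omega> = t \<bar> stratum_number (T n \<omega>) = k) =
           tree_prob n t / (\<Sum>s\<in>stratum k. tree_prob n s)"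
proof -
  have "{\<omega> \<in> space M. T n \<omega> = t \<and> stratum_number (T n \<omega>) = k} = {\<omega> \<in> space M. T n \<omega> = t}"
    using stratum_number_stratum[OF assms] by auto
  then show ?thesis
    by (simp add: cond_prob_def prob_stratum_number tree_prob_def)
qed

text \<open>For \<open>k \<le> n\<close> the stratum has \<open>fact k\<close> trees and positive
  mass, so conditional probabilities \<open>1 / fact k\<close> amount to equal probabilities; for
  \<open>k > n\<close> the law is constantly 0. Hence all \<open>k\<close> can be treated
  alike.\<close>

lemma equiprobable_at_iff:
  "equiprobable_at M T n \<longleftrightarrow> (\<forall>k. tree_prob n constant_on stratum k)"
proof
  assume eq: "equiprobable_at M T n"
  have "tree_prob n t = (if k \<le> n then (\<Sum>s\<in>stratum k. tree_prob n s) / fact k else 0)"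
    if t: "t \<in> stratum k" for t k
  proof (cases "k \<le> n")
    case True
    have "0 < (\<Sum>s\<in>stratum k. tree_prob n s)"
      using t tree_prob_pos[OF _ True] by (intro sum_pos) (auto simp: finite_stratum)
    moreover have "tree_prob n t / (\<Sum>s\<in>stratum k. tree_prob n s) = 1 / fact k"
      using eq t True unfolding equiprobable_at_def cond_prob_tree[OF t, symmetric] by blast
    ultimately show ?thesis
      using True by (simp add: field_simps)
  qed (use t tree_prob_eq_0 in auto)
  then show "\<forall>k. tree_prob n constant_on stratum k"
    unfolding constant_on_def by blast
next
  assume const: "\<forall>k. tree_prob n constant_on stratum k"
  have "tree_prob n t / (\<Sum>s\<in>stratum k. tree_prob n s) = 1 / fact k"
    if "k \<le> n" and t: "t \<in> stratum k" for k t
  proof -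
    have "tree_prob n s = tree_prob n t" if "s \<in> stratum k" for s
      using const that t by (metis constant_on_def)
    then have "(\<Sum>s\<in>stratum k. tree_prob n s) = fact k * tree_prob n t"
      by (simp add: card_stratum)
    then show ?thesis
      using tree_prob_pos[OF t \<open>k \<le> n\<close>] by simp
  qed
  then show "equiprobable_at M T n"
    by (simp add: equiprobable_at_def cond_prob_tree)
qed

lemma equiprobable_at_0: "equiprobable_at M T 0"
proof -
  have "tree_prob 0 constant_on stratum k" for k
  proof (cases "k = 0")
    case True
    then show ?thesis
      by (auto simp: constant_on_def stratum_0)
  next
    case False
    then show ?thesis
      using tree_prob_eq_0[of _ k 0] by (auto simp: constant_on_def)
  qed
  then show ?thesis
    by (simp add: equiprobable_at_iff)
qed

lemma equiprobable_at_Suc_iff: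
  assumes "equiprobable_at M T n"
  shows "equiprobable_at M T (Suc n) \<longleftrightarrow>
           (\<forall>k<n. (\<lambda>t. \<Sum>s\<in>stratum (Suc k). Q k s t) constant_on stratum k)"
proof -
  obtain c where c: "\<And>k t. t \<in> stratum k \<Longrightarrow> tree_prob n t = c k"
    using assms unfolding equiprobable_at_iff constant_on_def by metis
  have c_pos: "0 < c k" if "k \<le> n" for k
  proof -
    have "stratum k \<noteq> {}"
      using card_stratum[of k] by force
    then show ?thesis
      using c tree_prob_pos[OF _ that] by fastforce
  qed
  have c_0: "c k = 0" if "n < k" for k
  proof -
    have "stratum k \<noteq> {}"
      using card_stratum[of k] by force
    then show ?thesis
      using c tree_prob_eq_0[OF _ that] by fastforce
  qed
  \<comment> \<open>\<open>b k\<close> is the part of the next law on stratum \<open>k\<close> that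
    involves no deletion matrix: insertion for positive \<open>k\<close>, staying put for
    \<open>k = 0\<close>. It depends on the stratum only.\<close>
  define b where "b k = (case k of 0 \<Rightarrow> q * c 0 | Suc j \<Rightarrow> p / real (Suc j) * c j)" for k
  have step: "tree_prob (Suc n) t = b k + c (Suc k) * (\<Sum>s\<in>stratum (Suc k). Q k s t)"
    if t: "t \<in> stratum k" for k t
  proof (cases k)
    case 0
    with t have "t = single_node"
      by (simp add: stratum_0)
    moreover have "tree_prob n single_node = c 0"
      by (rule c) (simp add: stratum_0)
    ultimately show ?thesis
      using 0 c[of _ 1] by (simp add: b_def tree_prob_Suc_single_node sum_distrib_left mult.commute)
  next
    case (Suc j)
    with t obtain s v where s: "s \<in> stratum j" and v: "v \<in> {1..Suc j}" and "t = attach s v"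
      by (auto elim: stratum_Suc_cases)
    then show ?thesis
      using Suc tree_prob_Suc_attach[OF s v, of n] c
      by (simp add: b_def sum_distrib_left mult.commute)
  qed
  \<comment> \<open>For \<open>n \<le> k\<close> the weight \<open>c (Suc k)\<close> is 0 and the
    column sums have no effect; for \<open>k < n\<close> it is positive and can be
    cancelled.\<close>
  have "tree_prob (Suc n) constant_on stratum k \<longleftrightarrow>
      n \<le> k \<or> (\<lambda>t. \<Sum>s\<in>stratum (Suc k). Q k s t) constant_on stratum k" for k
  proof (cases "n \<le> k")
    case True
    then show ?thesis
      using step[of _ k] c_0[of "Suc k"] by (auto simp: constant_on_def)
  next
    case False
    then have "0 < c (Suc k)"
      by (intro c_pos) simp
    then have "tree_prob (Suc n) s = tree_prob (Suc n) t \<longleftrightarrow>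
        (\<Sum>r\<in>stratum (Suc k). Q k r s) = (\<Sum>r\<in>stratum (Suc k). Q k r t)"
      if "s \<in> stratum k" "t \<in> stratum k" for s t
      using that by (simp add: step)
    with False show ?thesis
      by (simp add: constant_on_iff_pairwise)
  qed
  then show ?thesis
    unfolding equiprobable_at_iff by (metis not_le)
qed

text \<open>The one-step criterion presupposes equiprobability at the earlier time, so two
  consecutive times are paired. Left to right the criterion applies directly; conversely, the
  induction hypothesis first supplies the earlier time.\<close>

lemma equiprobable_at_and_Suc_iff:
  "equiprobable_at M T n \<and> equiprobable_at M T (Suc n) \<longleftrightarrow>
     (\<forall>k<n. (\<lambda>t. \<Sum>s\<in>stratum (Suc k). Q k s t) constant_on stratum k)"
proof (induction n)
  case 0
  then show ?case
    using equiprobable_at_Suc_iff[OF equiprobable_at_0] equiprobable_at_0 by simp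
next
  case (Suc n)
  then show ?case
    using equiprobable_at_Suc_iff[of "Suc n"] by (metis less_Suc_eq)
qed

end

section \<open>Deletion matrices and their column sums\<close>

lemma column_sum_deletion_matrix:
  assumes L: "stratum_listing L" and j: "j < fact k"
  shows "column_sum (deletion_matrix L Q k) j = (\<Sum>s\<in>stratum (Suc k). Q k s (L k ! j))"
proof -
  have "distinct (L (Suc k))" "set (L (Suc k)) = stratum (Suc k)"
    using L by (simp_all add: stratum_listing_def)
  moreover from this have "length (L (Suc k)) = fact (Suc k)"
    by (metis card_stratum distinct_card)
  ultimately have "bij_betw ((!) (L (Suc k))) {..<fact (Suc k)} (stratum (Suc k))"
    by (intro bij_betw_nth) auto
  with j show ?thesis
    unfolding column_sum_def deletion_matrix_def
    by (simp add: sum.reindex_bij_betw[symmetric])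
qed

text \<open>The listing has length \<open>fact k\<close>, so the column indices run through the
  whole stratum, whatever its order.\<close>

lemma column_sums_eq_iff:
  assumes L: "stratum_listing L"
  shows "(\<forall>i < fact k. \<forall>j < fact k. column_sum (deletion_matrix L Q k) i =
            column_sum (deletion_matrix L Q k) j) \<longleftrightarrow>
         (\<lambda>t. \<Sum>s\<in>stratum (Suc k). Q k s t) constant_on stratum k"
proof -
  have "distinct (L k)" and set: "set (L k) = stratum k"
    using L by (simp_all add: stratum_listing_def)
  then have "length (L k) = fact k"
    by (metis card_stratum distinct_card)
  then have stratum: "stratum k = (!) (L k) ` {..<fact k}"
    using set by (auto simp: set_conv_nth)
  show ?thesis
    unfolding constant_on_iff_pairwise stratum
    by (simp add: column_sum_deletion_matrix[OF L]) (simp add: Ball_def)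
qed

text \<open>Left multiplication by the row of ones yields the row of column sums; the scalar, if it
  exists, is their common value.\<close>

lemma proportional_ones_row_iff:
  assumes "A \<in> carrier_mat m l" and "0 < l"
  shows "proportional (ones_row m * A) (ones_row l) \<longleftrightarrow>
           (\<forall>i<l. \<forall>j<l. column_sum A i = column_sum A j)"
proof -
  have prod: "ones_row m * A = Matrix.mat 1 l (\<lambda>(i, j). column_sum A j)"
    using assms by (intro eq_matI) (auto simp: ones_row_def column_sum_def scalar_prod_def lessThan_atLeast0)
  have "ones_row m * A = c \<cdot>\<^sub>m ones_row l \<longleftrightarrow> (\<forall>j<l. column_sum A j = c)" for c
    unfolding prod by (auto simp: ones_row_def Matrix.mat_eq_iff)
  with \<open>0 < l\<close> show ?thesis
    unfolding proportional_def by metis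
qed

text \<open>Stratum \<open>k + 1\<close> is first reached at time \<open>k + 1\<close>, so its
  deletion matrix first affects the law at time \<open>k + 2\<close>. The matrices with
  \<open>k \<le> n - 1\<close> are thus those that can act in a step up to time
  \<open>n + 1\<close>.\<close>

theorem theorem2p1:
  fixes p q :: real
    and Q :: "nat \<Rightarrow> ltree \<Rightarrow> ltree \<Rightarrow> real"
    and L :: "nat \<Rightarrow> ltree list"
    and M :: "'w measure"
    and T :: "nat \<Rightarrow> 'w \<Rightarrow> ltree"
    and n :: nat
  assumes "0 < p" and "p < 1" and "q = 1 - p"
    and "stratum_listing L"
    and "deletion_rule q Q"
    and "tree_process p q Q M T"
    and "n \<ge> 1"
  shows "(equiprobable_at M T n \<and> equiprobable_at M T (n + 1) \<longleftrightarrow>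
            (\<forall>k\<le>n - 1. proportional (ones_row (fact (k + 1)) * deletion_matrix L Q k)
                                   (ones_row (fact k)))) \<and>
         ((\<forall>m\<ge>1. equiprobable_at M T m) \<longleftrightarrow>
            (\<forall>k. proportional (ones_row (fact (k + 1)) * deletion_matrix L Q k)
                              (ones_row (fact k)))) \<and>
         (\<forall>k\<le>n - 1. proportional (ones_row (fact (k + 1)) * deletion_matrix L Q k)
                                (ones_row (fact k)) \<longleftrightarrow>
            (\<forall>i < fact k. \<forall>j < fact k. column_sum (deletion_matrix L Q k) i
                                    = column_sum (deletion_matrix L Q k) j))"
proof -
  interpret tree_process_context p q Q M T
    using assms by unfold_locales auto
  let ?C = "\<lambda>k. (\<lambda>t. \<Sum>s\<in>stratum (Suc k). Q k s t) constant_on stratum k"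
  have sums: "proportional (ones_row (fact (k + 1)) * deletion_matrix L Q k) (ones_row (fact k)) \<longleftrightarrow>
      (\<forall>i < fact k. \<forall>j < fact k. column_sum (deletion_matrix L Q k) i =
         column_sum (deletion_matrix L Q k) j)" for k
    by (rule proportional_ones_row_iff) (auto simp: deletion_matrix_def)
  have prop_iff: "proportional (ones_row (fact (k + 1)) * deletion_matrix L Q k) (ones_row (fact k)) \<longleftrightarrow>
      ?C k" for k
    unfolding sums column_sums_eq_iff[OF \<open>stratum_listing L\<close>] ..
  \<comment> \<open>The truncated bound agrees with the strict one because \<open>n\<close> is
    positive.\<close>
  have "k \<le> n - 1 \<longleftrightarrow> k < n" for k
    using \<open>n \<ge> 1\<close> by auto
  then have 1: "equiprobable_at M T n \<and> equiprobable_at M T (n + 1) \<longleftrightarrow> (\<forall>k\<le>n - 1. ?C k)"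
    using equiprobable_at_and_Suc_iff[of n] by simp
  have 2: "(\<forall>m\<ge>1. equiprobable_at M T m) \<longleftrightarrow> (\<forall>k. ?C k)"
  proof
    assume eq: "\<forall>m\<ge>1. equiprobable_at M T m"
    show "\<forall>k. ?C k"
    proof
      fix k
      show "?C k"
        \<comment> \<open>Times \<open>k + 1\<close> and \<open>k + 2\<close> control all indices
          below \<open>k + 1\<close>, in particular \<open>k\<close>.\<close>
        using eq equiprobable_at_and_Suc_iff[of "Suc k"] by simp
    qed
  next
    assume "\<forall>k. ?C k"
    then show "\<forall>m\<ge>1. equiprobable_at M T m"
      using equiprobable_at_and_Suc_iff by blast
  qed
  show ?thesis
    unfolding prop_iff 1 2 using sums prop_iff by blast
qed

end
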